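(* Let $k \ge 3$ be an integer, let $m \ge 1$ be a multiple of $k-1$, and set $d = \frac{km}{k-1} - 1$. There exists a $K_{1,k}$-free graph $G$ with maximum degree $d$ and a partition $\mathcal{P}$ of $V(G)$ such that $|V_i| = 2m-1 = \frac{d(2k-2)+k-2}{k}$ for every $V_i \in \mathcal{P}$ and $G$ has no independent transversal with respect to $\mathcal{P}$. If in addition $d > k + \frac{2}{k-2}$, then these block sizes satisfy $|V_i| > d + k - 1$. Consequently, for every $k \ge 3$ the following assertion is false: for every $K_{1,k}$-free graph $G$ with maximum degree $d$ and every partition $\mathcal{P} = \{V_1,\ldots,V_r\}$ of $V(G)$ with $|V_i| \ge d+k-1$ for every $i$, $G$ has an independent transversal with respect to $\mathcal{P}$.
   Context: Graphs are finite and simple. A graph is $K_{1,k}$-free if it does not contain the star $K_{1,k}$ as an induced subgraph. For a graph $G$ and a partition $\mathcal{P} = \{V_1, \ldots, V_r\}$ of $V(G)$ into blocks, an independent transversal (IT) of $G$ with respect to $\mathcal{P}$ is an independent set $\{v_1, \ldots, v_r\}$ of $G$ with $v_i \in V_i$ for every $i$. *)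

theory Defs
  imports "Graph_Theory.Graph_Theory" "HOL-Library.Disjoint_Sets"
begin

text \<open>
  A finite simple graph is a \<^locale>\<open>pair_graph\<close>: each edge \<open>uv\<close> is the pair of opposite arcs
  \<open>(u, v)\<close> and \<open>(v, u)\<close>. Hence the degree of a vertex is its \<^const>\<open>out_degree\<close>.
\<close>

definition star_free :: "nat \<Rightarrow> 'a pair_pre_digraph \<Rightarrow> bool" where
  "star_free k G \<longleftrightarrow>
     \<not> (\<exists>H. induced_subgraph H (with_proj G) \<and> complete_bipartite_digraph 1 k H)"

text \<open>The inserted 0 only matters for the graph without vertices.\<close>

definition max_degree :: "'a pair_pre_digraph \<Rightarrow> nat" where
  "max_degree G = Max (insert 0 (out_degree (with_proj G) ` pverts G))"

definition independent_set :: "'a pair_pre_digraph \<Rightarrow> 'a set \<Rightarrow> bool" where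
  "independent_set G S \<longleftrightarrow> S \<subseteq> pverts G \<and> (\<forall>u\<in>S. \<forall>v\<in>S. (u, v) \<notin> parcs G)"

definition independent_transversal :: "'a pair_pre_digraph \<Rightarrow> 'a set set \<Rightarrow> 'a set \<Rightarrow> bool" where
  "independent_transversal G P S \<longleftrightarrow>
     independent_set G S \<and> (\<exists>f. (\<forall>V\<in>P. f V \<in> V) \<and> S = f ` P)"

end

(* Idea: cut each side of K_{m,m} into k - 1 cliques of size m / (k - 1) and take 2m - 1 disjoint
   copies of the result. A copy is regular of degree d and is covered by k - 1 cliques, hence
   K_{1,k}-free, and it still contains K_{m,m}: an independent set meets only one of its two sides.
   Arrange the copies 1, ..., 2m - 1 on a path whose gaps are the blocks 0, ..., 2m - 1: the left
   side of copy c goes into block c - 1 and its right side into block c, except that one left vertex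
   of each copy c <= m is moved to block 0, and one right vertex of each copy c >= m to block 2m - 1.
   Suppose that an independent transversal avoids the left side of the middle copy m. Then it meets
   block m - 1 in the right side of copy m - 1, hence block m - 2 in the right side of copy m - 2,
   and so on down to block 1. As all vertices of block 0 are left vertices of the copies up to m,
   none of them is available. If it avoids the right side of copy m, block 2m - 1 is blocked
   symmetrically. *)

theory Submission
  imports Defs "HOL-Library.Countable"
begin

section \<open>Degrees, induced stars and residue classes\<close>

lemma out_degree_with_proj:
  "out_degree (with_proj G) v = card {w. (v, w) \<in> parcs G}"
proof -
  have "out_arcs (with_proj G) v = Pair v ` {w. (v, w) \<in> parcs G}"
    by (auto simp: out_arcs_def)
  then show ?thesis
    by (simp add: out_degree_def card_image inj_on_def)
qed

text \<open>The leaves of an induced star with \<open>k\<close> leaves would be \<open>k\<close>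
  pairwise nonadjacent neighbours of its centre, so an edge among any \<open>k\<close> neighbours of
  a vertex rules the star out.\<close>

lemma star_freeI:
  assumes "\<And>u W. W \<subseteq> {w. (u, w) \<in> parcs G} \<Longrightarrow> card W = k \<Longrightarrow>
             \<exists>v\<in>W. \<exists>w\<in>W. (v, w) \<in> parcs G"
  shows "star_free k G"
  unfolding star_free_def
proof
  assume "\<exists>H. induced_subgraph H (with_proj G) \<and> complete_bipartite_digraph 1 k H"
  then obtain H U W where ind: "induced_subgraph H (with_proj G)" and verts: "verts H = U \<union> W"
    and disj: "U \<inter> W = {}" and "card U = 1" and W: "card W = k"
    and ends: "arcs_ends H = U \<times> W \<union> W \<times> U"
    by (auto simp: complete_bipartite_digraph_def)
  then obtain u where U: "U = {u}"
    by (auto simp: card_1_singleton_iff)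
  \<comment> \<open>\<open>H\<close> inherits the projections as its endpoint maps, so an arc of
    \<open>H\<close> is literally its pair of endpoints.\<close>
  have "tail H = fst" "head H = snd"
    and arcs: "arcs H = {e \<in> parcs G. fst e \<in> verts H \<and> snd e \<in> verts H}"
    using ind by (auto simp: induced_subgraph_def subgraph_def compatible_def)
  then have ends_arcs: "arcs_ends H = arcs H"
    by (simp add: arcs_ends_conv)
  have "W \<subseteq> {w. (u, w) \<in> parcs G}"
    using ends ends_arcs arcs U by auto
  then obtain v w where "v \<in> W" "w \<in> W" "(v, w) \<in> parcs G"
    using assms W by blast
  then have "(v, w) \<in> arcs_ends H"
    using ends_arcs arcs verts by auto
  then show False
    using ends disj \<open>v \<in> W\<close> \<open>w \<in> W\<close> by auto
qed

text \<open>For \<open>m = q * t\<close> this gives the size of a clique within one side of a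
  copy.\<close>

lemma card_residue_class:
  fixes q t r :: nat
  assumes "r < q"
  shows "card {j. j < q * t \<and> j mod q = r} = t"
proof -
  have "{j. j < q * t \<and> j mod q = r} = (\<lambda>i. r + q * i) ` {..<t}"
  proof (intro equalityI subsetI)
    fix j assume "j \<in> {j. j < q * t \<and> j mod q = r}"
    then have j: "j < q * t" "j mod q = r" by auto
    have "j div q < t"
      using j by (simp add: less_mult_imp_div_less mult.commute)
    moreover have "j = r + q * (j div q)"
      using mod_mult_div_eq[of j q] j by simp
    ultimately show "j \<in> (\<lambda>i. r + q * i) ` {..<t}" by blast
  next
    fix j assume "j \<in> (\<lambda>i. r + q * i) ` {..<t}"
    then obtain i where i: "i < t" "j = r + q * i" by auto
    have "q * Suc i \<le> q * t"
      using i by (intro mult_le_mono2) simp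
    then show "j \<in> {j. j < q * t \<and> j mod q = r}"
      using i assms by simp
  qed
  moreover have "inj_on (\<lambda>i. r + q * i) {..<t}"
    using assms by (auto simp: inj_on_def)
  ultimately show ?thesis
    by (simp add: card_image)
qed

section \<open>The graph and its blocks\<close>

text \<open>The triple \<open>(c, s, j)\<close> encodes vertex \<open>j\<close> of copy \<open>c\<close>, on the right side if \<open>s\<close> holds and on
  the left side otherwise; the vertices \<open>j\<close> of one side fall into cliques by \<open>j mod q\<close>, with
  \<open>q = k - 1\<close>.\<close>

definition site :: "nat \<Rightarrow> (nat \<times> bool \<times> nat) set" where
  "site m = {1..<2 * m} \<times> UNIV \<times> {..<m}"

definition adjacent :: "nat \<Rightarrow> nat \<times> bool \<times> nat \<Rightarrow> nat \<times> bool \<times> nat \<Rightarrow> bool" where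
  "adjacent q = (\<lambda>(c, s, i) (c', s', j). c = c' \<and> (s \<noteq> s' \<or> i \<noteq> j \<and> i mod q = j mod q))"

text \<open>The vertex moved to an end block is always vertex 0 of its side. For the left side of
  copy 1 and the right side of copy \<open>2 * m - 1\<close> the move changes nothing.\<close>

definition block_index :: "nat \<Rightarrow> nat \<times> bool \<times> nat \<Rightarrow> nat" where
  "block_index m = (\<lambda>(c, s, j).
     if s then if j = 0 \<and> m \<le> c then 2 * m - 1 else c
     else if j = 0 \<and> c \<le> m then 0 else c - 1)"

text \<open>The triples are coded by \<open>to_nat\<close> because the theorem asks for graphs on
  natural numbers.\<close>

definition path_graph :: "nat \<Rightarrow> nat \<Rightarrow> nat pair_pre_digraph" where
  "path_graph q m =
     \<lparr>pverts = to_nat ` site m,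
      parcs = {(to_nat x, to_nat y) | x y. x \<in> site m \<and> y \<in> site m \<and> adjacent q x y}\<rparr>"

definition block :: "nat \<Rightarrow> nat \<Rightarrow> nat set" where
  "block m b = to_nat ` {x \<in> site m. block_index m x = b}"

lemma finite_site: "finite (site m)"
  by (simp add: site_def)

lemma mem_parcs_path_graph_iff:
  "(u, v) \<in> parcs (path_graph q m) \<longleftrightarrow>
     (\<exists>x\<in>site m. \<exists>y\<in>site m. adjacent q x y \<and> u = to_nat x \<and> v = to_nat y)"
  unfolding path_graph_def pair_pre_digraph.simps by blast

lemma to_nat_mem_parcs_path_graph_iff:
  "(to_nat x, to_nat y) \<in> parcs (path_graph q m) \<longleftrightarrow> x \<in> site m \<and> y \<in> site m \<and> adjacent q x y"
  by (simp add: path_graph_def del: split_paired_Ex)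

lemma adjacent_sym: "adjacent q x y \<Longrightarrow> adjacent q y x"
  by (auto simp: adjacent_def)

lemma pair_graph_path_graph: "pair_graph (path_graph q m)"
proof
  have "parcs (path_graph q m) \<subseteq> to_nat ` site m \<times> to_nat ` site m"
    by (auto simp: path_graph_def)
  then show "finite (parcs (path_graph q m))"
    by (rule finite_subset) (simp add: finite_site)
  show "symmetric (with_proj (path_graph q m))"
    unfolding symmetric_def with_proj_simps
  proof (rule symI)
    fix u v assume "(u, v) \<in> parcs (path_graph q m)"
    then obtain x y where "u = to_nat x" "v = to_nat y" "x \<in> site m" "y \<in> site m" "adjacent q x y"
      unfolding mem_parcs_path_graph_iff by blast
    then show "(v, u) \<in> parcs (path_graph q m)"
      by (simp add: to_nat_mem_parcs_path_graph_iff adjacent_sym)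
  qed
qed (auto simp: path_graph_def finite_site adjacent_def)

section \<open>Star-freeness and regularity\<close>

text \<open>Pigeonhole: within a copy, the vertices of one residue mod \<open>q\<close> form a
  clique, both sides taken together. These \<open>q\<close> cliques cover the copy, so two of any
  \<open>q + 1\<close> neighbours of a vertex lie in the same clique.\<close>

lemma star_free_path_graph:
  assumes "0 < q"
  shows "star_free (Suc q) (path_graph q m)"
proof (rule star_freeI)
  fix u W assume W: "W \<subseteq> {w. (u, w) \<in> parcs (path_graph q m)}" "card W = Suc q"
  define col where "col w = (case from_nat w of (c :: nat, s :: bool, j) \<Rightarrow> j) mod q" for w
  have "col ` W \<subseteq> {..<q}"
    using assms by (auto simp: col_def)
  then have "\<not> inj_on col W"
    using card_inj_on_le[of col W "{..<q}"] W(2) by auto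
  then obtain v w where vw: "v \<in> W" "w \<in> W" "v \<noteq> w" "col v = col w"
    unfolding inj_on_def by blast
  have "(u, v) \<in> parcs (path_graph q m)" "(u, w) \<in> parcs (path_graph q m)"
    using W vw by auto
  then obtain x y z where xyz: "u = to_nat x" "v = to_nat y" "w = to_nat z"
    "y \<in> site m" "z \<in> site m" "adjacent q x y" "adjacent q x z"
    by (auto simp: path_graph_def)
  \<comment> \<open>The common neighbour \<open>x\<close> puts \<open>y\<close> and \<open>z\<close>
    in one copy. Being distinct with equal residues, they are adjacent whether or not their sides
    agree.\<close>
  then have "adjacent q y z"
    using vw(3,4) by (auto simp: col_def adjacent_def split: prod.splits)
  then have "(v, w) \<in> parcs (path_graph q m)"
    using xyz by (simp add: to_nat_mem_parcs_path_graph_iff)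
  then show "\<exists>v\<in>W. \<exists>w\<in>W. (v, w) \<in> parcs (path_graph q m)"
    using vw(1,2) by blast
qed

lemma neighbours_path_graph:
  assumes "x \<in> site m"
  shows "{w. (to_nat x, w) \<in> parcs (path_graph q m)} = to_nat ` {y \<in> site m. adjacent q x y}"
proof (intro equalityI subsetI)
  fix w assume "w \<in> {w. (to_nat x, w) \<in> parcs (path_graph q m)}"
  then obtain y where "y \<in> site m" "adjacent q x y" "w = to_nat y"
    unfolding mem_Collect_eq mem_parcs_path_graph_iff to_nat_split by blast
  then show "w \<in> to_nat ` {y \<in> site m. adjacent q x y}"
    by blast
next
  fix w assume "w \<in> to_nat ` {y \<in> site m. adjacent q x y}"
  then show "w \<in> {w. (to_nat x, w) \<in> parcs (path_graph q m)}"
    using assms by (elim imageE) (simp add: to_nat_mem_parcs_path_graph_iff)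
qed

text \<open>A vertex sees the \<open>q * t\<close> vertices of the opposite side and the other
  \<open>t - 1\<close> vertices of its own clique.\<close>

lemma out_degree_path_graph:
  assumes "0 < q" and "v \<in> pverts (path_graph q (q * t))"
  shows "out_degree (with_proj (path_graph q (q * t))) v = q * t + (t - 1)"
proof -
  let ?m = "q * t"
  obtain c s i where v: "v = to_nat (c, s, i)" and site: "(c, s, i) \<in> site ?m"
    using assms(2) by (auto simp: path_graph_def)
  let ?C = "{j. j < ?m \<and> j mod q = i mod q}"
  have i: "i \<in> ?C" and c: "1 \<le> c" "c < 2 * ?m"
    using site by (auto simp: site_def)
  have "out_degree (with_proj (path_graph q ?m)) v
      = card (to_nat ` {y \<in> site ?m. adjacent q (c, s, i) y})"
    unfolding v out_degree_with_proj neighbours_path_graph[OF site] ..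
  also have "\<dots> = card {y \<in> site ?m. adjacent q (c, s, i) y}"
    by (simp add: card_image)
  also have "{y \<in> site ?m. adjacent q (c, s, i) y}
      = {c} \<times> {\<not> s} \<times> {..<?m} \<union> {c} \<times> {s} \<times> (?C - {i})"
    using c i by (auto simp: adjacent_def site_def)
  also have "card \<dots> = card ({c} \<times> {\<not> s} \<times> {..<?m}) + card ({c} \<times> {s} \<times> (?C - {i}))"
    by (rule card_Un_disjoint) auto
  also have "\<dots> = ?m + card (?C - {i})"
    by (simp add: card_cartesian_product)
  also have "card (?C - {i}) = t - 1"
    using card_residue_class[of "i mod q" q t] i assms(1) by (simp add: card_Diff_singleton)
  finally show ?thesis .
qed

lemma max_degree_path_graph:
  assumes "0 < q" "0 < t"
  shows "max_degree (path_graph q (q * t)) = q * t + (t - 1)"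
proof -
  have "0 < q * t"
    using assms by simp
  then have "Suc 0 < 2 * (q * t)"
    by linarith
  \<comment> \<open>A concrete vertex of copy 1 shows that the graph is nonempty, so the set of
    degrees is a genuine singleton.\<close>
  then have "to_nat (1 :: nat, False, 0 :: nat) \<in> pverts (path_graph q (q * t))"
    using assms by (simp add: path_graph_def site_def image_iff)
  then have "out_degree (with_proj (path_graph q (q * t))) ` pverts (path_graph q (q * t))
      = {q * t + (t - 1)}"
    using out_degree_path_graph[OF assms(1), of _ t] by auto
  then show ?thesis
    by (simp add: max_degree_def)
qed

section \<open>Block sizes and the partition\<close>

text \<open>An inner block \<open>b\<close> receives the right side of copy \<open>b\<close> and the
  left side of copy \<open>b + 1\<close>, less exactly one moved vertex: from the left side if
  \<open>b < m\<close>, from the right side if \<open>m \<le> b\<close>. An end block has a full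
  side of \<open>m\<close> vertices and gains \<open>m - 1\<close> moved ones.\<close>

lemma card_block:
  assumes "0 < m" "b < 2 * m"
  shows "card (block m b) = 2 * m - 1"
proof -
  let ?S = "{x \<in> site m. block_index m x = b}"
  have "card ?S = 2 * m - 1"
  proof -
    consider "b = 0" | "0 < b" "b < m" | "m \<le> b" "b < 2 * m - 1" | "b = 2 * m - 1" "m \<le> b"
      using assms by linarith
    then show ?thesis
    proof cases
      case 1
      have eq: "?S = {1} \<times> {False} \<times> {..<m} \<union> {2..m} \<times> {False} \<times> {0}"
        using 1 assms by (auto simp: site_def block_index_def split: if_splits)
      show ?thesis
        unfolding eq using assms by (subst card_Un_disjoint) (auto simp: card_cartesian_product)
    next
      case 2
      have eq: "?S = {b} \<times> {True} \<times> {..<m} \<union> {Suc b} \<times> {False} \<times> {1..<m}"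
        using 2 assms by (auto simp: site_def block_index_def split: if_splits)
      show ?thesis
        unfolding eq using assms by (subst card_Un_disjoint) (auto simp: card_cartesian_product)
    next
      case 3
      have eq: "?S = {b} \<times> {True} \<times> {1..<m} \<union> {Suc b} \<times> {False} \<times> {..<m}"
        using 3 assms by (auto simp: site_def block_index_def split: if_splits)
      show ?thesis
        unfolding eq using assms by (subst card_Un_disjoint) (auto simp: card_cartesian_product)
    next
      case 4
      have eq: "?S = {b} \<times> {True} \<times> {..<m} \<union> {m..<b} \<times> {True} \<times> {0}"
        using 4 assms by (auto simp: site_def block_index_def split: if_splits)
      show ?thesis
        unfolding eq using assms 4 by (subst card_Un_disjoint) (auto simp: card_cartesian_product)
    qed
  qed
  then show ?thesis
    by (simp add: block_def card_image inj_on_def)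
qed

lemma block_index_less: "x \<in> site m \<Longrightarrow> block_index m x < 2 * m"
  by (auto simp: site_def block_index_def)

lemma partition_on_block:
  assumes "0 < m"
  shows "partition_on (pverts (path_graph q m)) (block m ` {..<2 * m})"
proof (rule partition_onI)
  show "\<Union> (block m ` {..<2 * m}) = pverts (path_graph q m)"
    using block_index_less unfolding block_def path_graph_def pair_pre_digraph.simps by blast
  show "disjnt B B'" if "B \<in> block m ` {..<2 * m}" "B' \<in> block m ` {..<2 * m}" "B \<noteq> B'" for B B'
    using that by (auto simp: block_def disjnt_def)
  show "{} \<notin> block m ` {..<2 * m}"
  proof
    assume "{} \<in> block m ` {..<2 * m}"
    then obtain b where "b < 2 * m" "block m b = {}"
      by auto
    then show False
      using card_block[of m b] assms by simp
  qed
qed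

section \<open>Absence of an independent transversal\<close>

lemma no_independent_transversal_path_graph:
  assumes "0 < m"
  shows "\<not> independent_transversal (path_graph q m) (block m ` {..<2 * m}) S"
proof
  assume "independent_transversal (path_graph q m) (block m ` {..<2 * m}) S"
  then obtain f where ind: "independent_set (path_graph q m) S"
    and f: "\<And>b. b < 2 * m \<Longrightarrow> f (block m b) \<in> block m b" and S: "S = f ` block m ` {..<2 * m}"
    by (auto simp: independent_transversal_def)
  \<comment> \<open>The blocking argument depends only on which sides of which copies
    \<open>S\<close> meets, not on the vertices chosen there.\<close>
  define sel where "sel c s \<longleftrightarrow> (\<exists>j. (c, s, j) \<in> site m \<and> to_nat (c, s, j) \<in> S)" for c s
  have excl: "\<not> (sel c False \<and> sel c True)" for c
  proof
    assume "sel c False \<and> sel c True"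
    then obtain i j where "to_nat (c, False, i) \<in> S" "to_nat (c, True, j) \<in> S"
      "(c, False, i) \<in> site m" "(c, True, j) \<in> site m"
      by (auto simp: sel_def)
    moreover have "adjacent q (c, False, i) (c, True, j)"
      by (simp add: adjacent_def)
    ultimately show False
      using ind to_nat_mem_parcs_path_graph_iff unfolding independent_set_def by blast
  qed
  have pick: "\<exists>c s j. sel c s \<and> (c, s, j) \<in> site m \<and> block_index m (c, s, j) = b"
    if b: "b < 2 * m" for b
  proof -
    obtain x where "f (block m b) = to_nat x" "x \<in> site m" "block_index m x = b"
      using f[OF b] unfolding block_def by blast
    moreover obtain c s j where "x = (c, s, j)"
      using prod_cases3 by blast
    moreover have "f (block m b) \<in> S"
      using S b by auto
    ultimately have "(c, s, j) \<in> site m" "block_index m (c, s, j) = b" "to_nat (c, s, j) \<in> S"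
      by auto
    then show ?thesis
      unfolding sel_def by blast
  qed
  \<comment> \<open>Vertices are moved only to the two end blocks, so an inner block offers no other
    sides than these two.\<close>
  have inner: "sel b True \<or> sel (Suc b) False" if b: "0 < b" "b < 2 * m - 1" for b
  proof -
    have "b < 2 * m"
      using b by linarith
    then obtain c s j where "sel c s" "(c, s, j) \<in> site m" "block_index m (c, s, j) = b"
      using pick by blast
    then show ?thesis
      using b by (cases s) (auto simp: site_def block_index_def split: if_splits)
  qed
  have first: "\<exists>c. 1 \<le> c \<and> c \<le> m \<and> sel c False"
  proof -
    obtain c s j where "sel c s" "(c, s, j) \<in> site m" "block_index m (c, s, j) = 0"
      using pick[of 0] assms by auto
    then show ?thesis
      using assms
      by (cases s) (auto simp: site_def block_index_def split: if_splits intro!: exI[of _ c])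
  qed
  have last: "\<exists>c. m \<le> c \<and> c < 2 * m \<and> sel c True"
  proof -
    obtain c s j where "sel c s" "(c, s, j) \<in> site m" "block_index m (c, s, j) = 2 * m - 1"
      using pick[of "2 * m - 1"] assms by auto
    then show ?thesis
      using assms
      by (cases s) (auto simp: site_def block_index_def split: if_splits intro!: exI[of _ c])
  qed
  \<comment> \<open>Copy \<open>m\<close> is the only one that lies in the ranges of both
    \<open>first\<close> and \<open>last\<close>. Blocking spreads from whichever of its sides is
    avoided.\<close>
  consider "\<not> sel m False" | "\<not> sel m True"
    using excl by blast
  then show False
  proof cases
    case 1
    \<comment> \<open>Descending from \<open>m\<close>: if the left side of copy
      \<open>n + 1\<close> is avoided, block \<open>n\<close> forces the right side of copy
      \<open>n\<close>, which excludes its left side.\<close>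
    have "\<not> sel c False" if "1 \<le> c" "c \<le> m" for c
      using that(2,1)
    proof (induction rule: inc_induct)
      case base
      then show ?case using 1 by simp
    next
      case (step n)
      then show ?case using inner[of n] excl[of n] by auto
    qed
    then show False using first by blast
  next
    case 2
    \<comment> \<open>The mirror image, ascending from \<open>m\<close>: block \<open>n\<close> now
      forces the left side of copy \<open>n + 1\<close>.\<close>
    have "\<not> sel c True" if "m \<le> c" "c < 2 * m" for c
      using that
    proof (induction rule: dec_induct)
      case base
      then show ?case using 2 by simp
    next
      case (step n)
      then show ?case using inner[of n] assms excl[of "Suc n"] by auto
    qed
    then show False using last by blast
  qed
qed

section \<open>Parameters in terms of \<open>k\<close>\<close>

text \<open>With \<open>q = k - 1\<close> and \<open>m = (k - 1) * t\<close> the degree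
  \<open>q * t + (t - 1)\<close> becomes \<open>k * t - 1\<close>, which is the required
  \<open>d\<close>. Both halves of the theorem are instances: arbitrary \<open>t\<close> for the
  first, \<open>t = 3\<close> for the second.\<close>

lemma counterexample:
  assumes "k \<ge> 3" "0 < t"
  defines "G \<equiv> path_graph (k - 1) ((k - 1) * t)"
    and "P \<equiv> block ((k - 1) * t) ` {..<2 * ((k - 1) * t)}"
  shows "pair_graph G" "star_free k G" "max_degree G = k * t - 1" "partition_on (pverts G) P"
    "\<And>V. V \<in> P \<Longrightarrow> card V = 2 * ((k - 1) * t) - 1" "\<not> independent_transversal G P S"
proof -
  have pos: "0 < k - 1" "0 < (k - 1) * t"
    using assms by auto
  have "(k - 1) * t + (t - 1) = k * t - 1"
    using assms(1,2) by (cases k) auto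
  then show "max_degree G = k * t - 1"
    using max_degree_path_graph[OF pos(1) assms(2)] by (simp add: G_def)
  show "star_free k G"
    using star_free_path_graph[OF pos(1)] assms(1) by (simp add: G_def)
  show "pair_graph G"
    unfolding G_def by (rule pair_graph_path_graph)
  show "partition_on (pverts G) P"
    unfolding G_def P_def using pos(2) by (rule partition_on_block)
  show "card V = 2 * ((k - 1) * t) - 1" if "V \<in> P" for V
    using that card_block[OF pos(2)] by (auto simp: P_def)
  show "\<not> independent_transversal G P S"
    unfolding G_def P_def using pos(2) by (rule no_independent_transversal_path_graph)
qed

theorem mainTheorem5:
  fixes k :: nat
  assumes "k \<ge> 3"
  shows
    "(\<forall>m d :: nat.
        m \<ge> 1 \<longrightarrow> (k - 1) dvd m \<longrightarrow>
        real d = real k * real m / (real k - 1) - 1 \<longrightarrow>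
        (\<exists>(G :: nat pair_pre_digraph) P.
           pair_graph G \<and> star_free k G \<and> max_degree G = d \<and>
           partition_on (pverts G) P \<and>
           (\<forall>V\<in>P. real (card V) = 2 * real m - 1 \<and>
                   2 * real m - 1 = (real d * (2 * real k - 2) + real k - 2) / real k) \<and>
           \<not> (\<exists>S. independent_transversal G P S) \<and>
           (real d > real k + 2 / (real k - 2) \<longrightarrow> (\<forall>V\<in>P. card V > d + k - 1))))
     \<and>
     \<not> (\<forall>(G :: nat pair_pre_digraph) d P.
           pair_graph G \<longrightarrow> star_free k G \<longrightarrow> max_degree G = d \<longrightarrow>
           partition_on (pverts G) P \<longrightarrow>
           (\<forall>V\<in>P. card V \<ge> d + k - 1) \<longrightarrow>
           (\<exists>S. independent_transversal G P S))"
proof (intro conjI allI impI notI)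
  fix m d :: nat
  assume m: "m \<ge> 1" and dvd: "(k - 1) dvd m"
    and d: "real d = real k * real m / (real k - 1) - 1"
  obtain t where mt: "m = (k - 1) * t"
    using dvd by (elim dvdE)
  have t: "0 < t"
    using m mt by (cases t) auto
  have rm: "real m = (real k - 1) * real t"
    using assms mt by (simp add: of_nat_diff)
  have rd: "real d = real k * real t - 1"
    using assms d rm by simp
  \<comment> \<open>This keeps the subtraction in \<open>k * t - 1\<close> from truncating, so the
    real equation for \<open>d\<close> carries over to natural numbers.\<close>
  have "1 \<le> k * t"
    using assms t by (simp add: Suc_le_eq)
  then have "real d = real (k * t - 1)"
    using rd by (simp add: of_nat_diff)
  then have dt: "d = k * t - 1"
    by (simp only: of_nat_eq_iff)
  have card_eq: "real (2 * m - 1) = 2 * real m - 1"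
    using m by (simp add: of_nat_diff)
  have size_eq: "2 * real m - 1 = (real d * (2 * real k - 2) + real k - 2) / real k"
    using assms by (simp add: rd rm field_simps)
  \<comment> \<open>In terms of \<open>t\<close>, the claim amounts to
    \<open>(k - 2) * t > k - 1\<close>. The hypothesis on \<open>d = k * t - 1\<close>, multiplied
    by \<open>k - 2\<close>, is this inequality times \<open>k\<close>.\<close>
  have big: "2 * m - 1 > d + k - 1" if "real d > real k + 2 / (real k - 2)"
  proof -
    have "(real k - 2) * real d > (real k - 2) * (real k + 2 / (real k - 2))"
      using that assms by (intro mult_strict_left_mono) auto
    also have "(real k - 2) * (real k + 2 / (real k - 2)) = (real k - 2) * real k + 2"
      using assms by (simp add: field_simps)
    finally have "real k * (real k - 1) < real k * ((real k - 2) * real t)"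
      by (simp add: rd algebra_simps)
    then have "real k - 1 < (real k - 2) * real t"
      using assms by (simp add: mult_less_cancel_left)
    then have "real (2 * m - 1) > real d + real k - 1"
      unfolding card_eq by (simp add: rd rm algebra_simps)
    moreover have "real (d + k - 1) = real d + real k - 1"
      using assms by (simp add: of_nat_diff)
    ultimately show ?thesis by linarith
  qed
  let ?G = "path_graph (k - 1) m" and ?P = "block m ` {..<2 * m}"
  show "\<exists>(G :: nat pair_pre_digraph) P.
           pair_graph G \<and> star_free k G \<and> max_degree G = d \<and>
           partition_on (pverts G) P \<and>
           (\<forall>V\<in>P. real (card V) = 2 * real m - 1 \<and>
                   2 * real m - 1 = (real d * (2 * real k - 2) + real k - 2) / real k) \<and>
           \<not> (\<exists>S. independent_transversal G P S) \<and>
           (real d > real k + 2 / (real k - 2) \<longrightarrow> (\<forall>V\<in>P. card V > d + k - 1))"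
  proof (rule exI[of _ ?G], rule exI[of _ ?P], intro conjI)
    show "\<forall>V\<in>?P. real (card V) = 2 * real m - 1 \<and>
                   2 * real m - 1 = (real d * (2 * real k - 2) + real k - 2) / real k"
      using counterexample(5)[OF assms t] size_eq card_eq unfolding mt by simp
    show "real d > real k + 2 / (real k - 2) \<longrightarrow> (\<forall>V\<in>?P. card V > d + k - 1)"
      using counterexample(5)[OF assms t] big unfolding mt by simp
  qed (use counterexample(1-4,6)[OF assms t] in \<open>simp_all add: mt dt\<close>)
next
  \<comment> \<open>For \<open>t = 3\<close> the blocks have \<open>6 * k - 7\<close> vertices and
    the bound \<open>d + k - 1\<close> is \<open>4 * k - 2\<close>, which is no larger since
    \<open>k \<ge> 3\<close>.\<close>
  let ?m = "(k - 1) * 3" and ?d = "k * 3 - 1"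
  let ?P = "block ?m ` {..<2 * ?m}"
  assume conj: "\<forall>(G :: nat pair_pre_digraph) d P.
           pair_graph G \<longrightarrow> star_free k G \<longrightarrow> max_degree G = d \<longrightarrow>
           partition_on (pverts G) P \<longrightarrow>
           (\<forall>V\<in>P. card V \<ge> d + k - 1) \<longrightarrow>
           (\<exists>S. independent_transversal G P S)"
  have "0 < (3 :: nat)" by simp
  note cex = counterexample[OF assms this]
  have "card V \<ge> ?d + k - 1" if "V \<in> ?P" for V
    using cex(5)[OF that] assms by simp
  then have "\<exists>S. independent_transversal (path_graph (k - 1) ?m) ?P S"
    by (intro conj[rule_format, OF cex(1,2,3,4)]) simp_all
  then show False
    using cex(6) by blast
qed

end
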